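(* For every integer $p\ge1$ and every $n\ge 0$, the coefficients $c'_{n,p}$ in the expansion $\omega^p=\sum_{n=0}^\infty c'_{n,p}R'_n$ are given by $$c'_{n,p}=(-1)^na^{n(n+3)/2}\sum_{\substack{\underline k=(k_1,\ldots,k_p)\\ k_i\ge0,\ \sum k_i=n}}a^{\varphi(\underline k)}\,\frac{[n]!}{[k_1]!\cdots[k_p]!},$$ where $\varphi(\underline k)=\sum_{i=1}^{p-1}r_i(r_{i-1}+r_i+2)$ with $r_i=n-(k_1+\cdots+k_i)=k_{i+1}+\cdots+k_p$ (so $r_0=n$).
   Context: $A$ is an indeterminate, $a=A^2$, $\{n\}=a^n-a^{-n}$, $[n]=\{n\}/\{1\}$, $\{n\}!=\{1\}\{2\}\cdots\{n\}$, $[n]!=[1][2]\cdots[n]$ (with $\{0\}!=[0]!=1$). $\mathcal B=\mathbb Z[A^{\pm1}][z]$ (the Kauffman bracket skein module of the solid torus, with $z$ the core); $\mathcal B^{ev}$ is the submodule generated by the even powers of $z$. The basis $\{e_i\}_{i\ge0}$ of $\mathcal B$ is defined by $e_0=1$, $e_1=z$, $e_i=ze_{i-1}-e_{i-2}$. The twist map $t:\mathcal B\to\mathcal B$ is the $\mathbb Z[A^{\pm1}]$-linear map with $t(e_i)=\mu_ie_i$, $\mu_i=(-1)^iA^{i^2+2i}$. The symmetric bilinear form $\langle\ ,\ \rangle$ on $\mathcal B$ (cabling the zero-framed Hopf link and taking the Kauffman bracket) is determined by $\langle f(z),e_i\rangle=f(\lambda_i)\langle e_i\rangle$ for all $f(z)\in\mathcal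 B$, where $\lambda_i=-a^{i+1}-a^{-i-1}$ and $\langle e_i\rangle=(-1)^i[i+1]$. One writes $\langle x\rangle=\langle x,1\rangle$. $R_n=\prod_{i=0}^{n-1}(z-\lambda_{2i})$ (with $R_0=1$) and $R'_n=(\{n\}!)^{-1}R_n$. One has $\langle R_n,z^{2k}\rangle=0$ for $k<n$, so formal series $\sum_{n\ge0}c_nR_n$ with $c_n\in\mathbb Q(A)$ pair with elements of $\mathcal B^{ev}$ by finite sums. Such series can be multiplied: since $R_n$ divides $R_{n+1}$, in the expansion $R_nR_m=\sum_kC^k_{n,m}R_k$ the coefficient $C_{n,m}^k$ vanishes if $n$ or $m$ exceeds $k$. The series $\omega=\omega_+$ is the unique such series with $\langle\omega,x\rangle=\langle t(x)\rangle$ for every $x\in\mathcal B^{ev}$, and $\omega^p$ denotes its $p$-th power; equivalently, $\omega^p$ is the unique series with $\langle\omega^p,x\rangle=\langle t^p(x)\rangle$ for every $x\in\mathcal B^{ev}$. *)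

theory Defs
  imports
    "HOL-Computational_Algebra.Computational_Algebra"
begin

section \<open>Scalars\<close>

text \<open>The field of rational functions in one indeterminate, realised as the
  field of fractions of the integer polynomials.\<close>

type_synonym QA = "int poly fract"

definition indetA :: QA where
  "indetA = to_fract [:0, 1:]"

definition a :: QA where
  "a = indetA ^ 2"

text \<open>The subring of integer Laurent polynomials in \<^const>\<open>indetA\<close>.\<close>

definition laurent_ring :: "QA set" where
  "laurent_ring = {to_fract f / indetA ^ k | f k. True}"

definition qbrace :: "nat \<Rightarrow> QA" where
  "qbrace n = a powi (int n) - a powi (- int n)"

definition qint :: "nat \<Rightarrow> QA" where
  "qint n = qbrace n / qbrace 1"

definition qbrace_fact :: "nat \<Rightarrow> QA" where
  "qbrace_fact n = (\<Prod>i=1..n. qbrace i)"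

definition qfact :: "nat \<Rightarrow> QA" where
  "qfact n = (\<Prod>i=1..n. qint i)"


section \<open>The skein module of the solid torus\<close>

text \<open>The skein module is the free module over \<^const>\<open>laurent_ring\<close> on the powers of
  the core \<open>z\<close>.  It is regarded inside the space of polynomials in \<open>z\<close> over the field of
  rational functions; the twist map and the bilinear form below are the extensions of the
  given ones to this space by linearity, and \<open>skeinBev\<close> is the
  \<^const>\<open>laurent_ring\<close>-submodule generated by the even powers of \<open>z\<close>.\<close>

definition z :: "QA poly" where
  "z = [:0, 1:]"

definition skeinBev :: "QA poly set" where
  "skeinBev = {(\<Sum>k<m. smult (c k) (z ^ (2 * k))) | c m. \<forall>k. c k \<in> laurent_ring}"

fun e :: "nat \<Rightarrow> QA poly" where
  "e 0 = 1"
| "e (Suc 0) = z"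
| "e (Suc (Suc i)) = z * e (Suc i) - e i"

text \<open>Coordinates with respect to a basis \<open>b\<close> of the space of polynomials: the unique
  finitely supported family of coefficients expressing \<open>x\<close>.\<close>

definition coords :: "(nat \<Rightarrow> QA poly) \<Rightarrow> QA poly \<Rightarrow> nat \<Rightarrow> QA" where
  "coords b x = (THE c. finite {i. c i \<noteq> 0} \<and> x = (\<Sum>i | c i \<noteq> 0. smult (c i) (b i)))"

definition mu :: "nat \<Rightarrow> QA" where
  "mu i = (-1) ^ i * indetA ^ (i ^ 2 + 2 * i)"

definition lam :: "nat \<Rightarrow> QA" where
  "lam i = - (a powi (int i + 1)) - a powi (- int i - 1)"

definition twist :: "QA poly \<Rightarrow> QA poly" where
  "twist x = (\<Sum>i | coords e x i \<noteq> 0. smult (mu i * coords e x i) (e i))"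

text \<open>The bilinear form, determined by its values
  \<open>f(\<lambda>\<^sub>i) \<langle>e\<^sub>i\<rangle>\<close> on pairs \<open>(f, e\<^sub>i)\<close>, where
  \<open>\<langle>e\<^sub>i\<rangle> = (-1)\<^sup>i [i+1]\<close>; see \<open>form_e\<close>, the linearity lemmas
  and \<open>form_sym\<close> below.\<close>

definition form :: "QA poly \<Rightarrow> QA poly \<Rightarrow> QA" where
  "form f x = (\<Sum>i | coords e x i \<noteq> 0. coords e x i * (poly f (lam i) * ((-1) ^ i * qint (i + 1))))"

definition bracket :: "QA poly \<Rightarrow> QA" where
  "bracket x = form x 1"


section \<open>Formal series in the \<open>R\<^sub>n\<close>\<close>

definition R :: "nat \<Rightarrow> QA poly" where
  "R n = (\<Prod>i<n. z - [:lam (2 * i):])"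

definition R' :: "nat \<Rightarrow> QA poly" where
  "R' n = smult (inverse (qbrace_fact n)) (R n)"

text \<open>The formal series \<open>\<Sum>\<^sub>n c\<^sub>n R\<^sub>n\<close> is represented by its family \<open>c\<close> of coefficients.\<close>

type_synonym series = "nat \<Rightarrow> QA"

text \<open>For \<open>x\<close> in \<^const>\<open>skeinBev\<close> the index set of the sum is finite; see
  \<open>finite_series_form\<close> below.\<close>

definition series_form :: "series \<Rightarrow> QA poly \<Rightarrow> QA" where
  "series_form c x = (\<Sum>n | form (R n) x \<noteq> 0. c n * form (R n) x)"

definition series_one :: series where
  "series_one = (\<lambda>k. if k = 0 then 1 else 0)"

text \<open>Here \<open>coords R (R n * R m) k\<close> is the structure constant \<open>C\<^sup>k\<^sub>n\<^sub>,\<^sub>m\<close>, which vanishes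
  unless \<open>n \<le> k\<close> and \<open>m \<le> k\<close>; see \<open>coords_R_mult_eq_0\<close> below.\<close>

definition series_mult :: "series \<Rightarrow> series \<Rightarrow> series" where
  "series_mult c d = (\<lambda>k. \<Sum>n\<le>k. \<Sum>m\<le>k. c n * d m * coords R (R n * R m) k)"

fun series_power :: "series \<Rightarrow> nat \<Rightarrow> series" where
  "series_power c 0 = series_one"
| "series_power c (Suc p) = series_mult c (series_power c p)"

definition omega :: series where
  "omega = (THE w. \<forall>x\<in>skeinBev. series_form w x = bracket (twist x))"

text \<open>The coefficient of \<open>R'\<^sub>n\<close> in \<open>\<omega>\<^sup>p\<close>: the terms of index \<open>n\<close> in
  \<open>\<omega>\<^sup>p = \<Sum>\<^sub>n c\<^sub>n R\<^sub>n = \<Sum>\<^sub>n c'\<^sub>n R'\<^sub>n\<close> agree.\<close>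

definition c' :: "nat \<Rightarrow> nat \<Rightarrow> QA" where
  "c' n p = (THE y. smult (series_power omega p n) (R n) = smult y (R' n))"


section \<open>The exponent in the formula\<close>

text \<open>A tuple \<open>(k\<^sub>1, \<dots>, k\<^sub>p)\<close> is a list of length \<open>p\<close>; the sum of its entries
  is \<open>n\<close>, so that the subtraction below does not truncate.\<close>

definition tuples :: "nat \<Rightarrow> nat \<Rightarrow> nat list set" where
  "tuples p n = {k. length k = p \<and> sum_list k = n}"

definition r :: "nat list \<Rightarrow> nat \<Rightarrow> nat" where
  "r k i = sum_list k - sum_list (take i k)"

definition phi :: "nat list \<Rightarrow> nat" where
  "phi k = (\<Sum>i=1..length k - 1. r k i * (r k (i - 1) + r k i + 2))"


section \<open>Well-definedness\<close>

lemma smult_sum_right: "smult (u::QA) (\<Sum>i\<in>S. f i) = (\<Sum>i\<in>S. smult u (f i))"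
  by (induction S rule: infinite_finite_induct) (auto simp: smult_add_right)

lemma graded_sum_eq_0:
  fixes b :: "nat \<Rightarrow> QA poly"
  assumes deg: "\<And>i. degree (b i) = i" and nz: "\<And>i. b i \<noteq> 0"
    and "(\<Sum>i<m. smult (c i) (b i)) = 0" "i < m"
  shows "c i = 0"
  using assms(3,4)
proof (induction m)
  case (Suc m)
  have "coeff (\<Sum>i<m. smult (c i) (b i)) m = 0"
    by (auto simp: coeff_sum deg intro!: sum.neutral coeff_eq_0)
  moreover have "coeff (\<Sum>i<Suc m. smult (c i) (b i)) m = 0"
    using Suc.prems by simp
  ultimately have "c m * lead_coeff (b m) = 0"
    by (simp add: deg)
  hence "c m = 0" using nz by simp
  with Suc show ?case by (auto simp: less_Suc_eq)
qed simp

lemma supp_sum_cong: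
  fixes b :: "nat \<Rightarrow> QA poly"
  assumes "\<And>i. i \<ge> m \<Longrightarrow> c i = 0"
  shows "(\<Sum>i | c i \<noteq> 0. smult (c i) (b i)) = (\<Sum>i<m. smult (c i) (b i))"
  by (rule sum.mono_neutral_left) (use assms not_less in auto)

lemma finite_supp_bound:
  assumes "finite {i::nat. c i \<noteq> (0::QA)}"
  obtains m where "\<And>i. i \<ge> m \<Longrightarrow> c i = 0"
proof -
  obtain m where "\<forall>i\<in>{i. c i \<noteq> 0}. i < m"
    using finite_nat_set_iff_bounded assms by blast
  thus ?thesis using that[of m] by (meson mem_Collect_eq not_le)
qed

lemma graded_span:
  fixes b :: "nat \<Rightarrow> QA poly"
  assumes deg: "\<And>i. degree (b i) = i" and nz: "\<And>i. b i \<noteq> 0" and "degree x < m"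
  shows "\<exists>c. (\<forall>i\<ge>m. c i = 0) \<and> x = (\<Sum>i<m. smult (c i) (b i))"
  using assms(3)
proof (induction m arbitrary: x)
  case (Suc m)
  define u where "u = coeff x m / lead_coeff (b m)"
  define y where "y = x - smult u (b m)"
  have "coeff y m = 0"
    using nz[of m] deg[of m] leading_coeff_0_iff[of "b m"] by (simp add: y_def u_def)
  moreover have "degree y \<le> m"
    unfolding y_def using Suc.prems by (intro degree_diff_le) (auto simp: deg degree_smult_le)
  ultimately have y: "y = 0 \<or> degree y < m"
    by (metis leading_coeff_0_iff le_neq_implies_less)
  have "\<exists>c. (\<forall>i\<ge>m. c i = 0) \<and> y = (\<Sum>i<m. smult (c i) (b i))"
  proof (cases "y = 0")
    case True
    thus ?thesis by (intro exI[of _ "\<lambda>_. 0"]) simp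
  qed (use Suc.IH y in blast)
  then obtain c where c: "\<forall>i\<ge>m. c i = 0" "y = (\<Sum>i<m. smult (c i) (b i))" by blast
  have "x = (\<Sum>i<Suc m. smult ((c(m := u)) i) (b i))"
    using c(2) by (simp add: y_def algebra_simps)
  with c(1) show ?case by (intro exI[of _ "c(m := u)"]) auto
qed simp

lemma coords_unique:
  assumes deg: "\<And>i. degree (b i) = i" and nz: "\<And>i. b i \<noteq> 0"
    and "\<And>i. i \<ge> m \<Longrightarrow> c i = 0" and "x = (\<Sum>i<m. smult (c i) (b i))"
  shows "coords b x = c"
  unfolding coords_def
proof (rule the_equality)
  have "{i. c i \<noteq> 0} \<subseteq> {..<m}" using assms(3) not_less by auto
  thus "finite {i. c i \<noteq> 0} \<and> x = (\<Sum>i | c i \<noteq> 0. smult (c i) (b i))"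
    using assms(4) supp_sum_cong[where m = m and c = c and b = b, OF assms(3)] by (auto intro: finite_subset)
next
  fix d assume d: "finite {i. d i \<noteq> 0} \<and> x = (\<Sum>i | d i \<noteq> 0. smult (d i) (b i))"
  then obtain m' where m': "\<And>i. i \<ge> m' \<Longrightarrow> d i = 0" using finite_supp_bound by blast
  define M where "M = max m m'"
  have "x = (\<Sum>i<M. smult (d i) (b i))"
    using d supp_sum_cong[where m = M and c = d and b = b] m' by (auto simp: M_def)
  moreover have "x = (\<Sum>i<M. smult (c i) (b i))"
    using assms(4) supp_sum_cong[where m = M and c = c and b = b] supp_sum_cong[where m = m and c = c and b = b] assms(3) by (auto simp: M_def)
  ultimately have "(\<Sum>i<M. smult (d i - c i) (b i)) = 0"
    by (simp add: smult_diff_left sum_subtractf)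
  hence "d i = c i" if "i < M" for i
    using graded_sum_eq_0[OF deg nz, where m = M and c = "\<lambda>i. d i - c i"] that by simp
  moreover have "d i = c i" if "\<not> i < M" for i
    using that m' assms(3) by (simp add: M_def)
  ultimately show "d = c" by blast
qed

lemma coords_props:
  assumes deg: "\<And>i. degree (b i) = i" and nz: "\<And>i. b i \<noteq> 0"
  shows "degree x < i \<Longrightarrow> coords b x i = 0"
    and "degree x < m \<Longrightarrow> x = (\<Sum>i<m. smult (coords b x i) (b i))"
proof -
  have *: "(\<forall>i\<ge>m. coords b x i = 0) \<and> x = (\<Sum>i<m. smult (coords b x i) (b i))"
    if "degree x < m" for m
    using graded_span[OF deg nz that] coords_unique[OF deg nz, of m _ x] by (metis (full_types))
  show "degree x < i \<Longrightarrow> coords b x i = 0" using * by blast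
  show "degree x < m \<Longrightarrow> x = (\<Sum>i<m. smult (coords b x i) (b i))" using * by blast
qed

lemma coords_linear:
  assumes deg: "\<And>i. degree (b i) = i" and nz: "\<And>i. b i \<noteq> 0"
  shows "coords b (x + y) i = coords b x i + coords b y i"
    and "coords b (smult u x) i = u * coords b x i"
    and "coords b (b j) i = (if i = j then 1 else 0)"
proof -
  define m where "m = Suc (max (degree x) (degree y))"
  have m: "degree x < m" "degree y < m" by (auto simp: m_def)
  note p = coords_props[OF deg nz]
  have "coords b (x + y) = (\<lambda>i. coords b x i + coords b y i)"
  proof (rule coords_unique[OF deg nz, of m])
    show "x + y = (\<Sum>i<m. smult (coords b x i + coords b y i) (b i))"
      using p(2)[OF m(1)] p(2)[OF m(2)] by (simp add: smult_add_left sum.distrib)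
  qed (use m p(1) in auto)
  thus "coords b (x + y) i = coords b x i + coords b y i" by simp
  have "coords b (smult u x) = (\<lambda>i. u * coords b x i)"
  proof (rule coords_unique[OF deg nz, of m])
    have "smult u x = smult u (\<Sum>i<m. smult (coords b x i) (b i))" using p(2)[OF m(1)] by simp
    also have "\<dots> = (\<Sum>i<m. smult (u * coords b x i) (b i))"
      by (simp add: smult_sum_right)
    finally show "smult u x = (\<Sum>i<m. smult (u * coords b x i) (b i))" .
  qed (use m p(1) in auto)
  thus "coords b (smult u x) i = u * coords b x i" by simp
  have "coords b (b j) = (\<lambda>i. if i = j then 1 else 0)"
  proof (rule coords_unique[OF deg nz, of "Suc j"])
    have "(\<Sum>i<Suc j. smult (if i = j then 1 else 0) (b i)) = (\<Sum>i<Suc j. if i = j then b i else 0)"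
      by (rule sum.cong) auto
    thus "b j = (\<Sum>i<Suc j. smult (if i = j then 1 else 0) (b i))" by simp
  qed auto
  thus "coords b (b j) i = (if i = j then 1 else 0)" by simp
qed

lemma degree_e_aux: "degree (e i) = i \<and> lead_coeff (e i) = 1"
proof (induction i rule: e.induct)
  case (3 i)
  have ne: "e (Suc i) \<noteq> 0" using 3 by auto
  have d: "degree (z * e (Suc i)) = Suc (Suc i)"
    using 3 ne by (subst degree_mult_eq) (auto simp: z_def)
  have l: "degree (z * e (Suc i) - e i) = Suc (Suc i)"
    using degree_add_eq_left[of "- e i" "z * e (Suc i)"] d 3 by simp
  have "lead_coeff (z * e (Suc i)) = 1"
    unfolding lead_coeff_mult using 3 by (auto simp: z_def)
  hence "coeff (z * e (Suc i)) (Suc (Suc i)) = 1" by (simp only: d)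
  moreover have "coeff (e i) (Suc (Suc i)) = 0"
    using 3 by (intro coeff_eq_0) simp
  ultimately have "coeff (z * e (Suc i) - e i) (Suc (Suc i)) = 1"
    by (simp only: coeff_diff diff_zero)
  with l show ?case by simp
qed (auto simp: z_def)

lemma degree_e: "degree (e i) = i" and e_nz: "e i \<noteq> 0"
  using degree_e_aux[of i] by auto

lemma degree_R: "degree (R n) = n" and R_nz: "R n \<noteq> 0"
proof -
  have "degree (R n) = n \<and> R n \<noteq> 0"
  proof (induction n)
    case (Suc n)
    have "z - [:lam (2 * n):] = [:- lam (2 * n), 1:]" by (simp add: z_def)
    moreover have "R (Suc n) = R n * (z - [:lam (2 * n):])" by (simp add: R_def)
    ultimately show ?case using Suc by (simp add: degree_mult_eq del: mult_pCons_right)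
  qed (simp add: R_def)
  thus "degree (R n) = n" "R n \<noteq> 0" by auto
qed

lemmas coords_e = coords_props[of e, OF degree_e e_nz] coords_linear[of e, OF degree_e e_nz]
lemmas coords_R = coords_props[of R, OF degree_R R_nz] coords_linear[of R, OF degree_R R_nz]

lemma twist_bound:
  assumes "degree x < m"
  shows "twist x = (\<Sum>i<m. smult (mu i * coords e x i) (e i))"
  unfolding twist_def
proof (rule sum.mono_neutral_left)
  show "{i. coords e x i \<noteq> 0} \<subseteq> {..<m}"
  proof (intro subsetI, rule ccontr)
    fix i assume "i \<in> {i. coords e x i \<noteq> 0}" "i \<notin> {..<m}"
    thus False using assms coords_e(1)[of x i] by simp
  qed
qed auto

lemma form_bound:
  assumes "degree x < m"
  shows "form f x = (\<Sum>i<m. coords e x i * (poly f (lam i) * ((-1) ^ i * qint (i + 1))))"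
  unfolding form_def
proof (rule sum.mono_neutral_left)
  show "{i. coords e x i \<noteq> 0} \<subseteq> {..<m}"
  proof (intro subsetI, rule ccontr)
    fix i assume "i \<in> {i. coords e x i \<noteq> 0}" "i \<notin> {..<m}"
    thus False using assms coords_e(1)[of x i] by simp
  qed
qed auto

lemma degree_bound2:
  obtains m where "degree x < m" "degree y < m" "degree (x + y) < m" "degree (smult u x) < m"
proof -
  have "degree (smult u x) \<le> degree x" by (rule degree_smult_le)
  thus ?thesis
    by (intro that[of "Suc (degree x + degree y + degree (x + y))"]) auto
qed

lemma twist_add: "twist (x + y) = twist x + twist y"
  and twist_smult: "twist (smult u x) = smult u (twist x)"
proof -
  obtain m where m: "degree x < m" "degree y < m" "degree (x + y) < m" "degree (smult u x) < m"
    by (rule degree_bound2)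
  show "twist (x + y) = twist x + twist y"
    by (simp add: twist_bound[OF m(1)] twist_bound[OF m(2)] twist_bound[OF m(3)] coords_e(3-5)
        ring_distribs smult_add_left sum.distrib)
  show "twist (smult u x) = smult u (twist x)"
    by (simp add: twist_bound[OF m(1)] twist_bound[OF m(4)] coords_e(3-5) smult_sum_right mult_ac)
qed

lemma twist_e: "twist (e i) = smult (mu i) (e i)"
proof -
  have "{j. coords e (e i) j \<noteq> 0} = {i}" by (auto simp: coords_e(3-5))
  thus ?thesis by (simp add: twist_def coords_e(3-5))
qed

lemma form_add_right: "form f (x + y) = form f x + form f y"
  and form_smult_right: "form f (smult u x) = u * form f x"
proof -
  obtain m where m: "degree x < m" "degree y < m" "degree (x + y) < m" "degree (smult u x) < m"
    by (rule degree_bound2)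
  show "form f (x + y) = form f x + form f y"
    by (simp add: form_bound[OF m(1)] form_bound[OF m(2)] form_bound[OF m(3)] coords_e(3-5)
        distrib_right sum.distrib)
  show "form f (smult u x) = u * form f x"
    by (simp add: form_bound[OF m(1)] form_bound[OF m(4)] coords_e(3-5) sum_distrib_left mult_ac)
qed

lemma form_add_left: "form (f + g) x = form f x + form g x"
  by (simp add: form_def distrib_left distrib_right sum.distrib)

lemma form_smult_left: "form (smult u f) x = u * form f x"
  by (simp add: form_def sum_distrib_left mult_ac)

lemma form_e: "form f (e i) = poly f (lam i) * ((-1) ^ i * qint (i + 1))"
proof -
  have "{j. coords e (e i) j \<noteq> 0} = {i}" by (auto simp: coords_e(3-5))
  thus ?thesis by (simp add: form_def coords_e(3-5))
qed

lemma indetA_nz [simp]: "indetA \<noteq> 0"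
  by (simp add: indetA_def)

lemma a_nz [simp]: "a \<noteq> 0"
  by (simp add: a_def)

lemma poly_e_lam: "poly (e i) (lam j) * qbrace (j + 1) = (-1) ^ i * qbrace ((i + 1) * (j + 1))"
proof (induction i rule: e.induct)
  case 2
  define u where "u = a ^ Suc j"
  have "u \<noteq> 0" by (simp add: u_def)
  have "lam j = - u - inverse u" "qbrace (j + 1) = u - inverse u"
    by (simp_all add: lam_def qbrace_def u_def power_int_minus power_int_def nat_add_distrib
        field_simps)
  moreover have "qbrace (2 * (j + 1)) = u ^ 2 - inverse (u ^ 2)"
    by (simp only: qbrace_def u_def power_int_minus power_int_of_nat power_mult[symmetric] Suc_eq_plus1
        mult.commute)
  ultimately have "lam j * qbrace (j + 1) = - qbrace (2 * (j + 1))" using \<open>u \<noteq> 0\<close>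
    by (simp only:) (simp add: field_simps power2_eq_square)
  thus ?case by (simp add: z_def mult_2)
next
  case (3 i)
  define u where "u = a ^ Suc j"
  have u: "u \<noteq> 0" by (simp add: u_def)
  have lam: "lam j = - u - inverse u"
    by (simp_all add: lam_def u_def power_int_minus power_int_def nat_add_distrib field_simps)
  have q: "qbrace (k * (j + 1)) = u ^ k - inverse (u ^ k)" for k
    by (simp only: qbrace_def u_def power_int_minus power_int_of_nat power_mult[symmetric] Suc_eq_plus1
        mult.commute)
  have "poly (e (Suc (Suc i))) (lam j) * qbrace (j + 1)
      = lam j * (poly (e (Suc i)) (lam j) * qbrace (j + 1)) - poly (e i) (lam j) * qbrace (j + 1)"
    by (simp add: z_def algebra_simps)
  also have "\<dots> = lam j * ((-1) ^ Suc i * qbrace ((Suc i + 1) * (j + 1)))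
      - (-1) ^ i * qbrace ((i + 1) * (j + 1))"
    by (simp only: 3)
  also have "\<dots> = (-1) ^ i * ((u + inverse u) * (u ^ (i + 2) - inverse (u ^ (i + 2)))
      - (u ^ (i + 1) - inverse (u ^ (i + 1))))"
    by (simp only: q lam) (simp add: algebra_simps)
  also have "(u + inverse u) * (u ^ (i + 2) - inverse (u ^ (i + 2)))
      - (u ^ (i + 1) - inverse (u ^ (i + 1))) = u ^ (i + 3) - inverse (u ^ (i + 3))"
    using u by (simp add: field_simps power_add power2_eq_square power3_eq_cube)
  also have "(-1) ^ i * (u ^ (i + 3) - inverse (u ^ (i + 3)))
      = (-1) ^ Suc (Suc i) * qbrace ((Suc (Suc i) + 1) * (j + 1))"
    by (simp only: q) (simp add: numeral_3_eq_3)
  finally show ?case .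
qed simp

lemma form_e_e: "form (e i) (e j) = (-1) ^ (i + j) * qint ((i + 1) * (j + 1))"
proof -
  have "form (e i) (e j) = (-1) ^ j * (poly (e i) (lam j) * qbrace (j + 1)) / qbrace 1"
    by (simp add: form_e qint_def)
  thus ?thesis by (simp only: poly_e_lam) (simp add: qint_def power_add mult_ac)
qed

lemma form_sym: "form x y = form y x"
proof -
  define m where "m = Suc (max (degree x) (degree y))"
  have sr: "form f (\<Sum>i<k. smult (c i) (e i)) = (\<Sum>i<k. c i * form f (e i))" for f c and k :: nat
  proof (induction k)
    case 0
    show ?case using form_smult_right[of f 0 0] by simp
  qed (simp add: form_add_right form_smult_right)
  have sl: "form (\<Sum>i<k. smult (c i) (e i)) f = (\<Sum>i<k. c i * form (e i) f)" for f c and k :: nat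
  proof (induction k)
    case 0
    show ?case using form_smult_left[of 0 0 f] by simp
  qed (simp add: form_add_left form_smult_left)
  have *: "form x y = (\<Sum>i<m. \<Sum>j<m. coords e x i * (coords e y j * form (e i) (e j)))"
    if "degree x < m" "degree y < m" for x y
  proof -
    have "form x y = form (\<Sum>i<m. smult (coords e x i) (e i)) (\<Sum>i<m. smult (coords e y i) (e i))"
      by (rule arg_cong2[OF coords_e(2)[OF that(1)] coords_e(2)[OF that(2)]])
    thus ?thesis by (simp only: sl) (simp only: sr sum_distrib_left)
  qed
  have m: "degree x < m" "degree y < m" by (auto simp: m_def)
  show ?thesis
    unfolding *[OF m] *[OF m(2,1)]
    by (subst (2) sum.swap) (simp only: form_e_e mult_ac add_ac)
qed

lemma form_R_even:
  assumes "k < n"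
  shows "form (R n) (z ^ (2 * k)) = 0"
proof -
  have zz: "z * e (Suc i) = e (Suc (Suc i)) + e i" for i by simp
  have ev: "\<exists>c. z ^ (2 * k) = (\<Sum>j\<le>k. smult (c j) (e (2 * j)))" for k
  proof (induction k)
    case 0
    show ?case by (intro exI[of _ "\<lambda>_. 1"]) simp
  next
    case (Suc k)
    then obtain c where c: "z ^ (2 * k) = (\<Sum>j\<le>k. smult (c j) (e (2 * j)))" by blast
    define S where "S = {y. \<exists>d. y = (\<Sum>j\<le>Suc k. smult (d j) (e (2 * j)))}"
    have S_add: "y + w \<in> S" if yw: "y \<in> S" "w \<in> S" for y w
    proof -
      from yw obtain d d' where "y = (\<Sum>j\<le>Suc k. smult (d j) (e (2 * j)))"
        "w = (\<Sum>j\<le>Suc k. smult (d' j) (e (2 * j)))" unfolding S_def by blast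
      hence "y + w = (\<Sum>j\<le>Suc k. smult (d j + d' j) (e (2 * j)))"
        by (simp only: smult_add_left sum.distrib)
      thus ?thesis unfolding S_def by (intro CollectI exI[of _ "\<lambda>j. d j + d' j"])
    qed
    have S_0: "0 \<in> S"
      unfolding S_def by (intro CollectI exI[of _ "\<lambda>_. 0"]) simp
    have S_smult: "smult u y \<in> S" if y: "y \<in> S" for u y
    proof -
      from y obtain d where "y = (\<Sum>j\<le>Suc k. smult (d j) (e (2 * j)))" unfolding S_def by blast
      hence "smult u y = (\<Sum>j\<le>Suc k. smult (u * d j) (e (2 * j)))"
        by (simp only: smult_sum_right smult_smult)
      thus ?thesis unfolding S_def by (intro CollectI exI[of _ "\<lambda>j. u * d j"])
    qed
    have S_e: "e (2 * i) \<in> S" if i: "i \<le> Suc k" for i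
    proof -
      have "(\<Sum>j\<le>Suc k. smult (if j = i then 1 else 0) (e (2 * j)))
          = (\<Sum>j\<le>Suc k. if j = i then e (2 * j) else 0)"
        by (rule sum.cong) auto
      also have "\<dots> = e (2 * i)" using i by simp
      finally show ?thesis
        unfolding S_def by (intro CollectI exI[of _ "\<lambda>j. if j = i then 1 else 0"]) (rule sym)
    qed
    have zze: "z * (z * e (2 * j)) \<in> S" if j: "j \<le> k" for j
    proof (cases j)
      case 0
      have "z * (z * e (2 * j)) = e (2 * 1) + e (2 * 0)"
        using 0 by (simp add: numeral_2_eq_2)
      thus ?thesis using S_add S_e by (metis Suc_le_mono le0 One_nat_def)
    next
      case (Suc i)
      have "z * (z * e (2 * j)) = z * (z * e (Suc (2 * i + 1)))" using Suc by simp
      also have "\<dots> = z * e (Suc (2 * i + 2)) + z * e (Suc (2 * i))"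
        by (simp only: zz distrib_left) simp
      also have "\<dots> = (e (2 * (i + 2)) + e (2 * (i + 1))) + (e (2 * (i + 1)) + e (2 * i))"
        by (simp only: zz) (simp add: algebra_simps)
      also have "\<dots> \<in> S"
        using Suc j by (intro S_add S_e) auto
      finally show ?thesis .
    qed
    have "z ^ (2 * Suc k) = z * (z * z ^ (2 * k))" by simp
    also have "\<dots> = (\<Sum>j\<le>k. smult (c j) (z * (z * e (2 * j))))"
      by (simp only: c sum_distrib_left mult_smult_right)
    also have "\<dots> \<in> S"
    proof -
      have "(\<Sum>j\<in>J. smult (c j) (z * (z * e (2 * j)))) \<in> S" if "finite J" "J \<subseteq> {..k}" for J
        using that by (induction J rule: finite_induct) (auto intro!: S_0 S_add S_smult zze)
      thus ?thesis by simp
    qed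
    finally show ?case unfolding S_def by blast
  qed
  then obtain c where c: "z ^ (2 * k) = (\<Sum>j\<le>k. smult (c j) (e (2 * j)))" by blast
  have van: "form (R n) (e (2 * j)) = 0" if "j \<le> k" for j
  proof -
    have "poly (R n) (lam (2 * j)) = (\<Prod>i<n. lam (2 * j) - lam (2 * i))"
      by (simp add: R_def poly_prod z_def)
    also have "\<dots> = 0" using that assms by (intro prod_zero) auto
    finally show ?thesis by (simp add: form_e)
  qed
  have "form (R n) (\<Sum>j\<in>J. smult (c j) (e (2 * j))) = 0" if "finite J" "J \<subseteq> {..k}" for J
    using that
  proof (induction J rule: finite_induct)
    case empty
    show ?case using form_smult_right[of "R n" 0 0] by simp
  qed (auto simp: form_add_right form_smult_right van)
  thus ?thesis by (simp add: c)
qed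

lemma finite_series_form:
  assumes "x \<in> skeinBev"
  shows "finite {n. form (R n) x \<noteq> 0}"
proof -
  from assms obtain c m where x: "x = (\<Sum>k<m. smult (c k) (z ^ (2 * k)))"
    unfolding skeinBev_def by blast
  have "form (R n) (\<Sum>k<l. smult (c k) (z ^ (2 * k))) = 0" if "l \<le> m" "m \<le> n" for n l
    using that
  proof (induction l)
    case 0
    show ?case using form_smult_right[of "R n" 0 0] by simp
  qed (simp add: form_add_right form_smult_right form_R_even)
  hence "{n. form (R n) x \<noteq> 0} \<subseteq> {..<m}"
    unfolding x using not_less by blast
  thus ?thesis by (rule finite_subset) simp
qed

lemma R_dvd: "n \<le> k \<Longrightarrow> R n dvd R k"
  unfolding R_def by (rule prod_dvd_prod_subset) auto

lemma coords_R_mult_eq_0: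
  assumes "k < max n m"
  shows "coords R (R n * R m) k = 0"
proof -
  have *: "coords R x k = 0" if dv: "R n dvd x" and kn: "k < n" for x n k
    using kn
  proof (induction k rule: less_induct)
    case (less k)
    define M where "M = Suc (degree x + k)"
    have x: "x = (\<Sum>i<M. smult (coords R x i) (R i))"
      by (rule coords_R(2)) (simp add: M_def)
    have "R (Suc k) dvd smult (coords R x i) (R i)" if "i \<noteq> k" for i
      using that less by (cases "i < k") (auto intro!: dvd_smult R_dvd)
    hence d1: "R (Suc k) dvd (\<Sum>i\<in>{..<M}-{k}. smult (coords R x i) (R i))"
      by (intro dvd_sum) auto
    have d2: "R (Suc k) dvd x"
      using less.prems dv by (meson R_dvd Suc_leI dvd_trans)
    have "x = smult (coords R x k) (R k)
        + (\<Sum>i\<in>{..<M}-{k}. smult (coords R x i) (R i))"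
      by (rule trans[OF x], rule sum.remove) (auto simp: M_def)
    hence "R (Suc k) dvd smult (coords R x k) (R k)
        + (\<Sum>i\<in>{..<M}-{k}. smult (coords R x i) (R i))"
      using d2 by (rule subst)
    hence "R (Suc k) dvd smult (coords R x k) (R k)"
      by (simp only: dvd_add_left_iff[OF d1])
    hence "smult (coords R x k) (R k) = 0 \<or> degree (R (Suc k)) \<le> degree (smult (coords R x k) (R k))"
      by (auto dest: dvd_imp_degree_le)
    thus ?case using R_nz by (auto simp: degree_R split: if_splits)
  qed
  show ?thesis
  proof (cases "k < n")
    case True
    thus ?thesis using *[of n] by simp
  next
    case False
    thus ?thesis using *[of m] assms by simp
  qed
qed

end

theory Submission
  imports Defs
begin

text \<open>Pairing a series with \<open>e\<^sub>2\<^sub>j\<close> amounts to evaluating it at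
  \<open>\<lambda>\<^sub>2\<^sub>j\<close>. These evaluations are multiplicative, and they determine the series because
  \<open>R\<^sub>n(\<lambda>\<^sub>2\<^sub>j) = (-1)\<^sup>n {j+n}!/{j-n}!\<close> is triangular in \<open>n\<close> and \<open>j\<close>. Since \<open>\<omega>\<close> evaluates to
  \<open>\<mu>\<^sub>2\<^sub>j\<close>, which is \<open>a\<close> to the power \<open>2j(j+1)\<close>, it suffices to show that the claimed
  coefficients of \<open>\<omega>\<^sup>p\<close> evaluate to the \<open>p\<close>-th power of this. Splitting off \<open>k\<^sub>1\<close> from the
  tuples reduces the step from \<open>p\<close> to \<open>p + 1\<close> to a one-parameter sum, which is Cauchy's
  \<open>q\<close>-binomial formula \<open>power_eq_sum_gauss_binom\<close> with base \<open>a\<^sup>-\<^sup>2\<close>. The induction can start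
  at \<open>p = 0\<close>.\<close>

section \<open>Gaussian binomials\<close>

text \<open>Taking the q-Pascal recurrence as definition avoids division, so \<open>q\<close> may
  lie in any commutative ring.\<close>

fun gauss_binom :: "'a::comm_ring_1 \<Rightarrow> nat \<Rightarrow> nat \<Rightarrow> 'a" where
  "gauss_binom q n 0 = 1"
| "gauss_binom q 0 (Suc k) = 0"
| "gauss_binom q (Suc n) (Suc k) = gauss_binom q n k + q ^ Suc k * gauss_binom q n (Suc k)"

lemma gauss_binom_eq_0: "n < k \<Longrightarrow> gauss_binom q n k = 0"
  by (induction q n k rule: gauss_binom.induct) auto

lemma gauss_binom_self [simp]: "gauss_binom q n n = 1"
  by (induction n) (auto simp: gauss_binom_eq_0)

text \<open>With \<open>P k\<close> the product over \<open>i < k\<close>, one has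
  \<open>x * P k = P (Suc k) + q ^ k * P k\<close>. Multiplying an expansion in the
  \<open>P k\<close> by \<open>x\<close> thus changes its coefficients by the q-Pascal
  recurrence.\<close>

lemma power_eq_sum_gauss_binom:
  "x ^ n = (\<Sum>k\<le>n. gauss_binom q n k * (\<Prod>i<k. x - q ^ i))"
proof (induction n)
  case (Suc n)
  define P where "P k = (\<Prod>i<k. x - q ^ i)" for k
  have P: "x * P k = P (Suc k) + q ^ k * P k" for k
    by (simp add: P_def algebra_simps)
  have "x ^ Suc n = (\<Sum>k\<le>n. gauss_binom q n k * (x * P k))"
    by (simp add: Suc P_def sum_distrib_left mult_ac)
  also have "\<dots> = (\<Sum>k\<le>n. gauss_binom q n k * P (Suc k)) + (\<Sum>k\<le>n. q ^ k * gauss_binom q n k * P k)"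
    by (simp add: P distrib_left sum.distrib mult_ac)
  \<comment> \<open>The added top term is zero; with it, splitting off \<open>P 0\<close> leaves the
    same range as in the other sum.\<close>
  also have "(\<Sum>k\<le>n. q ^ k * gauss_binom q n k * P k)
      = (\<Sum>k\<le>Suc n. q ^ k * gauss_binom q n k * P k)"
    by (simp add: gauss_binom_eq_0)
  also have "\<dots> = P 0 + (\<Sum>k\<le>n. q ^ Suc k * gauss_binom q n (Suc k) * P (Suc k))"
    by (subst sum.atMost_Suc_shift) simp
  finally have "x ^ Suc n = P 0 + (\<Sum>k\<le>n. gauss_binom q (Suc n) (Suc k) * P (Suc k))"
    by (simp add: sum.distrib distrib_right del: power_Suc)
  thus ?case
    by (subst sum.atMost_Suc_shift) (simp add: P_def)
qed simp


section \<open>Quantum factorials\<close>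

text \<open>\<open>a\<close> is not a root of unity: the equation descends to integer polynomials,
  where the left side has degree \<open>2 * n\<close>. Division by the values of
  \<open>qbrace\<close> rests on this.\<close>

lemma a_power_eq_1_iff: "a ^ n = 1 \<longleftrightarrow> n = 0"
proof
  assume "a ^ n = 1"
  moreover have "to_fract (f ^ k) = to_fract f ^ k" for f :: "int poly" and k
    by (induction k) simp_all
  ultimately have "to_fract ([:0, 1:] ^ (2 * n) :: int poly) = to_fract 1"
    by (simp only: a_def indetA_def power_mult to_fract_1)
  hence "([:0, 1:] ^ (2 * n) :: int poly) = 1"
    by (simp only: to_fract_eq_iff)
  hence "degree ([:0, 1:] ^ (2 * n) :: int poly) = 0"
    by simp
  thus "n = 0"
    by (simp add: degree_power_eq)
qed simp

lemma qbrace_eq: "qbrace n = a ^ n - inverse (a ^ n)"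
  by (simp add: qbrace_def power_int_minus)

lemma qbrace_nz [simp]: "n > 0 \<Longrightarrow> qbrace n \<noteq> 0"
proof
  assume "n > 0" "qbrace n = 0"
  hence "a ^ (n + n) = 1"
    by (simp add: qbrace_eq power_add field_simps)
  with \<open>n > 0\<close> show False
    by (simp only: a_power_eq_1_iff)
qed

lemma qbrace_fact_0 [simp]: "qbrace_fact 0 = 1"
  and qbrace_fact_Suc: "qbrace_fact (Suc n) = qbrace_fact n * qbrace (Suc n)"
  by (simp_all add: qbrace_fact_def)

lemma qbrace_fact_nz [simp]: "qbrace_fact n \<noteq> 0"
  by (simp add: qbrace_fact_def)

lemma qfact_eq: "qfact n = qbrace_fact n / qbrace 1 ^ n"
  by (simp add: qfact_def qbrace_fact_def qint_def prod_dividef)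

lemma qfact_0 [simp]: "qfact 0 = 1"
  by (simp add: qfact_def)

lemma qfact_nz [simp]: "qfact n \<noteq> 0"
  by (simp add: qfact_eq)

lemma qbinom_eq:
  "qfact (m + l) / (qfact l * qfact m) = qbrace_fact (m + l) / (qbrace_fact l * qbrace_fact m)"
  by (simp add: qfact_eq power_add field_simps)

text \<open>Compares the symmetric quantum binomial with the Gaussian one at base a^(-2). The
  identity {k+l} = a^l {k} + a^(-k) {l} turns the two induction hypotheses into the q-Pascal
  recurrence.\<close>

lemma qbrace_fact_eq_gauss_binom:
  "qbrace_fact (k + l) =
     gauss_binom (inverse (a ^ 2)) (k + l) k * a ^ (k * l) * qbrace_fact k * qbrace_fact l"
proof (induction "k + l" arbitrary: k l)
  case (Suc n)
  show ?case
  proof (cases k)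
    case k: (Suc i)
    show ?thesis
    proof (cases l)
      case l: (Suc j)
      define B where "B = gauss_binom (inverse (a ^ 2)) n"
      have n: "i + l = n" "k + j = n" using Suc.hyps(2) k l by auto
      have 1: "qbrace_fact n = B i * a ^ (i * l) * qbrace_fact i * qbrace_fact l"
        and 2: "qbrace_fact n = B k * a ^ (k * j) * qbrace_fact k * qbrace_fact j"
        using Suc.hyps(1)[of i l] Suc.hyps(1)[of k j] n by (simp_all add: B_def)
      have split: "qbrace (k + l) = a ^ l * qbrace k + inverse (a ^ k) * qbrace l"
        by (simp add: qbrace_eq power_add field_simps)
      have "qbrace_fact (k + l) = qbrace_fact n * qbrace (k + l)"
        using Suc.hyps(2) by (metis qbrace_fact_Suc)
      also have "\<dots> = a ^ l * (B i * a ^ (i * l) * qbrace_fact i * qbrace_fact l) * qbrace k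
          + inverse (a ^ k) * (B k * a ^ (k * j) * qbrace_fact k * qbrace_fact j) * qbrace l"
        unfolding split by (subst 1[symmetric], subst 2[symmetric]) (simp add: algebra_simps)
      also have "\<dots> = (B i + inverse (a ^ 2) ^ k * B k) * a ^ (k * l)
          * qbrace_fact k * qbrace_fact l"
        by (simp add: k l qbrace_fact_Suc power_add field_simps power2_eq_square power_mult_distrib)
      also have "B i + inverse (a ^ 2) ^ k * B k = gauss_binom (inverse (a ^ 2)) (k + l) k"
        using Suc.hyps(2) by (simp add: B_def k flip: Suc.hyps(2))
      finally show ?thesis .
    qed simp
  qed simp
qed simp

section \<open>The one-parameter sum\<close>

lemma triangular_Suc:
  fixes l :: nat
  shows "Suc l * (Suc l + 3) div 2 = l * (l + 3) div 2 + (l + 2)"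
proof -
  have "Suc l * (Suc l + 3) = l * (l + 3) + (l + 2) * 2" by (simp add: algebra_simps)
  thus ?thesis by (simp only: div_mult_self1 div_mult_self2)
qed

lemma triangular_add:
  fixes m l :: nat
  shows "(m + l) * (m + l + 3) div 2 = m * (m + 3) div 2 + l * (l + 3) div 2 + m * l"
proof (induction l)
  case (Suc l)
  thus ?case
    using triangular_Suc[of "m + l"] triangular_Suc[of l] by simp
qed simp

text \<open>Each factor a^(2(m+1)) - a^(-2i) equals a^(m+1-i) {m+i+1}. The total power of
  \<open>a\<close> may be negative, so \<open>a ^ (l * l)\<close> is kept on the right.\<close>

lemma qbrace_fact_add_eq_prod:
  "a ^ (l * (l + 3) div 2) * a ^ (m * l) * qbrace_fact (m + l) =
     qbrace_fact m * a ^ (l * l) * (\<Prod>i<l. a ^ (2 * (m + 1)) - inverse (a ^ 2) ^ i)"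
proof (induction l)
  case (Suc l)
  have step: "a ^ (l + 2) * a ^ m * qbrace (Suc (m + l))
      = a ^ (2 * l + 1) * (a ^ (2 * (m + 1)) - inverse (a ^ 2) ^ l)"
  proof -
    define u v where "u = a ^ l" and "v = a ^ m"
    have nz: "u \<noteq> 0" "v \<noteq> 0" by (simp_all add: u_def v_def)
    have "a ^ (l + 2) = u * a ^ 2" "a ^ Suc (m + l) = v * u * a" "a ^ (2 * l + 1) = u ^ 2 * a"
      "a ^ (2 * (m + 1)) = v ^ 2 * a ^ 2" "inverse (a ^ 2) ^ l = inverse (u ^ 2)"
      by (simp_all add: u_def v_def power_add power_mult power_inverse
          power2_eq_square power_mult_distrib mult_ac)
    thus ?thesis
      unfolding qbrace_eq v_def[symmetric] using nz
      by (simp only:) (simp add: field_simps power2_eq_square)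
  qed
  have "a ^ (Suc l * (Suc l + 3) div 2) * a ^ (m * Suc l) * qbrace_fact (m + Suc l)
     = (a ^ (l * (l + 3) div 2) * a ^ (m * l) * qbrace_fact (m + l))
        * (a ^ (l + 2) * a ^ m * qbrace (Suc (m + l)))"
    unfolding triangular_Suc by (simp add: power_add qbrace_fact_Suc mult_ac)
  also have "\<dots> = qbrace_fact m * a ^ (Suc l * Suc l)
      * (\<Prod>i<Suc l. a ^ (2 * (m + 1)) - inverse (a ^ 2) ^ i)"
  proof -
    have "a ^ (Suc l * Suc l) = a ^ (l * l) * a ^ (2 * l + 1)"
      by (simp add: mult_2 add_ac flip: power_add)
    thus ?thesis unfolding Suc step prod.lessThan_Suc by (simp only: mult_ac)
  qed
  finally show ?case .
qed simp

text \<open>Up to the common factor {K+N}!/{N}!, the summands are those of Cauchy's formula for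
  \<open>x ^ N\<close> with \<open>x = a ^ (2 * (K + N + 1))\<close> and base a^(-2).\<close>

lemma sum_qbrace_fact:
  "(\<Sum>l\<le>N. a ^ (l * (l + 3) div 2 + K * l) * (qbrace_fact (K + N + l) / (qbrace_fact l * qbrace_fact (N - l))))
     = a ^ (2 * N * (K + N + 1)) * (qbrace_fact (K + N) / qbrace_fact N)"
proof -
  define x where "x = a ^ (2 * (K + N + 1))"
  define Q where "Q = inverse (a ^ 2)"
  have term_eq: "a ^ (l * (l + 3) div 2 + K * l) * (qbrace_fact (K + N + l) / (qbrace_fact l * qbrace_fact (N - l)))
      = (qbrace_fact (K + N) / qbrace_fact N) * (gauss_binom Q N l * (\<Prod>i<l. x - Q ^ i))"
    if l: "l \<le> N" for l
  proof -
    obtain d where d: "N = l + d" using l le_Suc_ex by blast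
    define P where "P = (\<Prod>i<l. x - Q ^ i)"
    define T where "T = a ^ (l * (l + 3) div 2)"
    have 1: "T * (a ^ (K * l) * a ^ (l * l) * a ^ (l * d)) * qbrace_fact (K + N + l)
        = qbrace_fact (K + N) * a ^ (l * l) * P"
    proof -
      have "a ^ (K * l) * a ^ (l * l) * a ^ (l * d) = a ^ ((K + N) * l)"
        unfolding d power_add[symmetric]
        by (rule arg_cong[where f = "(^) a"]) (simp add: algebra_simps)
      thus ?thesis
        unfolding T_def P_def x_def Q_def by (simp only: qbrace_fact_add_eq_prod)
    qed
    have 2: "qbrace_fact N = gauss_binom Q N l * a ^ (l * d) * qbrace_fact l * qbrace_fact d"
      using qbrace_fact_eq_gauss_binom[of l d] by (simp add: Q_def d)
    \<comment> \<open>The cancellation for abstract field elements: \<open>k\<close>,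
      \<open>u\<close>, \<open>w\<close> stand for \<open>a ^ (K * l)\<close>,
      \<open>a ^ (l * l)\<close>, \<open>a ^ (l * d)\<close>, and \<open>b\<close> for the Gaussian
      binomial.\<close>
    have *: "t * k * (f / (x * y)) = g / (b * w * x * y) * (b * P)"
      if "t * (k * u * w) * f = g * u * P" "u \<noteq> 0" "w \<noteq> 0" "b * w * x * y \<noteq> 0"
      for t k f x y g b w u :: QA
    proof -
      have "t * k * w * f = g * P" using that(1,2) by (simp add: mult_ac)
      moreover have "t * k * (f / (x * y)) = t * k * w * f / (w * x * y)" using that(3) by simp
      ultimately have "t * k * (f / (x * y)) = g * P / (w * x * y)" by (simp only:)
      also have "\<dots> = g / (b * w * x * y) * (b * P)" using that(4) by simp
      finally show ?thesis .
    qed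
    have "N - l = d" using d by simp
    \<comment> \<open>The Gaussian binomial is nonzero because this product is
      \<open>qbrace_fact N\<close>.\<close>
    moreover have "gauss_binom Q N l * a ^ (l * d) * qbrace_fact l * qbrace_fact d \<noteq> 0"
      by (simp only: 2[symmetric] qbrace_fact_nz not_False_eq_True)
    ultimately show ?thesis
      unfolding 2 power_add T_def[symmetric] P_def[symmetric] by (simp only:) (rule *[OF 1]; simp)
  qed
  have "(\<Sum>l\<le>N. a ^ (l * (l + 3) div 2 + K * l) * (qbrace_fact (K + N + l) / (qbrace_fact l * qbrace_fact (N - l))))
      = (qbrace_fact (K + N) / qbrace_fact N) * (\<Sum>l\<le>N. gauss_binom Q N l * (\<Prod>i<l. x - Q ^ i))"
    unfolding sum_distrib_left by (rule sum.cong) (simp_all only: term_eq atMost_iff)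
  also have "\<dots> = (qbrace_fact (K + N) / qbrace_fact N) * x ^ N"
    by (simp only: power_eq_sum_gauss_binom[symmetric])
  also have "x ^ N = a ^ (2 * N * (K + N + 1))"
    unfolding x_def power_mult[symmetric] by (simp only: mult_ac)
  finally show ?thesis by (simp add: mult.commute)
qed


section \<open>Sums over tuples\<close>

definition tuple_sum :: "nat \<Rightarrow> nat \<Rightarrow> QA" where
  "tuple_sum p n = (\<Sum>k\<in>tuples p n. a ^ phi k * (qfact n / (\<Prod>i\<leftarrow>k. qfact i)))"

lemma tuples_0: "tuples 0 n = (if n = 0 then {[]} else {})"
  by (auto simp: tuples_def)

text \<open>The index \<open>m\<close> is the sum of the tail, that is r_1, in which the recursion
  for \<open>phi\<close> is expressed.\<close>

lemma tuples_Suc: "tuples (Suc p) n = (\<Union>m\<le>n. (#) (n - m) ` tuples p m)"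
proof (intro equalityI subsetI)
  fix k assume "k \<in> tuples (Suc p) n"
  then obtain x k' where k: "k = x # k'" "length k' = p" "x + sum_list k' = n"
    by (auto simp: tuples_def length_Suc_conv)
  hence "k \<in> (#) (n - sum_list k') ` tuples p (sum_list k')" by (auto simp: tuples_def)
  thus "k \<in> (\<Union>m\<le>n. (#) (n - m) ` tuples p m)" using k by auto
qed (auto simp: tuples_def)

lemma finite_tuples: "finite (tuples p n)"
  by (induction p arbitrary: n) (auto simp: tuples_0 tuples_Suc)

text \<open>Dropping the head shifts \<open>r\<close> by one index, so only the summand
  \<open>i = 1\<close> is new. For empty \<open>k\<close> that summand is absent, in agreement with
  \<open>sum_list k = 0\<close>.\<close>

lemma phi_Cons: "phi (x # k) = sum_list k * (x + sum_list k + sum_list k + 2) + phi k"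
proof (cases k)
  case Nil
  thus ?thesis by (simp add: phi_def)
next
  case (Cons y k')
  have r: "r (x # k) (Suc i) = r k i" for i
    by (simp add: r_def)
  have r0: "r (x # k) 0 = x + sum_list k" "r k 0 = sum_list k"
    by (simp_all add: r_def)
  have sum_insert: "(\<Sum>i\<in>insert 1 (Suc ` I). g i) = g 1 + (\<Sum>i\<in>I. g (Suc i))"
    if "finite I" "0 \<notin> I" for I and g :: "nat \<Rightarrow> nat"
    using that by (subst sum.insert) (auto simp: sum.reindex)
  have len: "{1..length (x # k) - 1} = insert 1 (Suc ` {1..length k - 1})"
    using Cons by (simp add: image_Suc_atLeastAtMost) auto
  have "phi (x # k) = r (x # k) 1 * (r (x # k) 0 + r (x # k) 1 + 2)
      + (\<Sum>i=1..length k - 1. r (x # k) (Suc i) * (r (x # k) i + r (x # k) (Suc i) + 2))"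
    unfolding phi_def len by (subst sum_insert) simp_all
  also have "(\<Sum>i=1..length k - 1. r (x # k) (Suc i) * (r (x # k) i + r (x # k) (Suc i) + 2)) = phi k"
    unfolding phi_def
  proof (rule sum.cong)
    fix i assume "i \<in> {1..length k - 1}"
    hence "i = Suc (i - 1)" by simp
    thus "r (x # k) (Suc i) * (r (x # k) i + r (x # k) (Suc i) + 2)
        = r k i * (r k (i - 1) + r k i + 2)"
      by (metis r)
  qed simp
  finally show ?thesis using r0 r[of 0] by simp
qed

text \<open>The multinomial coefficient is a binomial times that of the tail; the explicit power of
  \<open>a\<close> is the summand \<open>i = 1\<close> of \<open>phi\<close>.\<close>

lemma tuple_sum_Suc:
  "tuple_sum (Suc p) n =
     (\<Sum>m\<le>n. qbrace_fact n / (qbrace_fact (n - m) * qbrace_fact m) * a ^ (m * (n + m + 2)) * tuple_sum p m)"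
proof -
  have "tuple_sum (Suc p) n
      = (\<Sum>m\<le>n. \<Sum>k\<in>(#) (n - m) ` tuples p m. a ^ phi k * (qfact n / (\<Prod>i\<leftarrow>k. qfact i)))"
    unfolding tuple_sum_def tuples_Suc
  proof (rule sum.UNION_disjoint)
    show "\<forall>m\<in>{..n}. \<forall>m'\<in>{..n}. m \<noteq> m' \<longrightarrow> (#) (n - m) ` tuples p m \<inter> (#) (n - m') ` tuples p m' = {}"
      by (auto simp: tuples_def)
  qed (simp_all add: finite_tuples)
  also have "\<dots> = (\<Sum>m\<le>n. qbrace_fact n / (qbrace_fact (n - m) * qbrace_fact m)
      * a ^ (m * (n + m + 2)) * tuple_sum p m)"
  proof (rule sum.cong)
    fix m assume "m \<in> {..n}"
    hence m: "m \<le> n" by simp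
    have q: "qbrace_fact n / (qbrace_fact (n - m) * qbrace_fact m) = qfact n / (qfact (n - m) * qfact m)"
      using qbinom_eq[of m "n - m"] m by simp
    have "(\<Sum>k\<in>(#) (n - m) ` tuples p m. a ^ phi k * (qfact n / (\<Prod>i\<leftarrow>k. qfact i)))
        = (\<Sum>k\<in>tuples p m. a ^ phi ((n - m) # k) * (qfact n / (qfact (n - m) * (\<Prod>i\<leftarrow>k. qfact i))))"
      by (subst sum.reindex) auto
    also have "\<dots> = (\<Sum>k\<in>tuples p m. qbrace_fact n / (qbrace_fact (n - m) * qbrace_fact m)
        * a ^ (m * (n + m + 2)) * (a ^ phi k * (qfact m / (\<Prod>i\<leftarrow>k. qfact i))))"
      using m by (intro sum.cong) (auto simp: phi_Cons tuples_def power_add q)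
    finally show "(\<Sum>k\<in>(#) (n - m) ` tuples p m. a ^ phi k * (qfact n / (\<Prod>i\<leftarrow>k. qfact i)))
        = qbrace_fact n / (qbrace_fact (n - m) * qbrace_fact m) * a ^ (m * (n + m + 2)) * tuple_sum p m"
      by (simp add: tuple_sum_def sum_distrib_left)
  qed simp
  finally show ?thesis .
qed

lemma tuple_sum_0: "tuple_sum 0 n = (if n = 0 then 1 else 0)"
  by (simp add: tuple_sum_def tuples_0 phi_def)

text \<open>This is the evaluation at \<open>lam (2 * j)\<close> with the signs already cancelled.
  After the sums are exchanged, the inner one is \<open>sum_qbrace_fact\<close> with
  \<open>K = 2 * m\<close> and \<open>N = j - m\<close>.\<close>

lemma sum_tuple_sum:
  "(\<Sum>n\<le>j. a ^ (n * (n + 3) div 2) * tuple_sum p n / qbrace_fact n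
      * (qbrace_fact (j + n) / qbrace_fact (j - n))) = (a ^ (2 * j * (j + 1))) ^ p"
proof (induction p)
  case 0
  have "(\<Sum>n\<le>j. a ^ (n * (n + 3) div 2) * tuple_sum 0 n / qbrace_fact n
      * (qbrace_fact (j + n) / qbrace_fact (j - n))) = (\<Sum>n\<le>j. if n = 0 then 1 else 0)"
    by (rule sum.cong) (auto simp: tuple_sum_0)
  thus ?case by simp
next
  case (Suc p)
  let ?t = "\<lambda>m n. a ^ (n * (n + 3) div 2) * a ^ (m * (n + m + 2)) * tuple_sum p m / qbrace_fact m
      * (qbrace_fact (j + n) / (qbrace_fact (n - m) * qbrace_fact (j - n)))"
  \<comment> \<open>The {n}! from the recursion cancels the denominator.\<close>
  have "(\<Sum>n\<le>j. a ^ (n * (n + 3) div 2) * tuple_sum (Suc p) n / qbrace_fact n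
      * (qbrace_fact (j + n) / qbrace_fact (j - n))) = (\<Sum>n\<le>j. \<Sum>m\<le>n. ?t m n)"
    by (simp add: tuple_sum_Suc sum_distrib_left sum_distrib_right sum_divide_distrib field_simps)
  also have "\<dots> = (\<Sum>m\<le>j. \<Sum>n=m..j. ?t m n)"
    by (subst sum.Sigma, simp, simp, subst sum.Sigma, simp, simp)
      (rule sum.reindex_bij_witness[of _ "\<lambda>(x, y). (y, x)" "\<lambda>(x, y). (y, x)"]; auto)
  also have "\<dots> = (\<Sum>m\<le>j. a ^ (2 * j * (j + 1)) * (a ^ (m * (m + 3) div 2) * tuple_sum p m / qbrace_fact m
      * (qbrace_fact (j + m) / qbrace_fact (j - m))))"
  proof (rule sum.cong)
    fix m assume "m \<in> {..j}"
    then obtain N where j: "j = m + N" using le_Suc_ex by auto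
    \<comment> \<open>\<open>C\<close> is the part independent of \<open>l\<close> once both
      exponents are expanded at \<open>n = m + l\<close>.\<close>
    define C where "C = a ^ (m * (m + 3) div 2) * a ^ (2 * m * (m + 1)) * tuple_sum p m / qbrace_fact m"
    have "(\<Sum>n=m..j. ?t m n) = (\<Sum>l\<le>N. ?t m (m + l))"
      unfolding j
      by (rule sum.reindex_bij_witness[of _ "\<lambda>l. m + l" "\<lambda>n. n - m"]) auto
    also have "\<dots> = (\<Sum>l\<le>N. C * (a ^ (l * (l + 3) div 2 + 2 * m * l)
        * (qbrace_fact (2 * m + N + l) / (qbrace_fact l * qbrace_fact (N - l)))))"
    proof (rule sum.cong)
      fix l
      have "a ^ ((m + l) * (m + l + 3) div 2) * a ^ (m * (m + l + m + 2))
          = a ^ (m * (m + 3) div 2) * a ^ (2 * m * (m + 1)) * a ^ (l * (l + 3) div 2 + 2 * m * l)"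
        unfolding triangular_add power_add[symmetric]
        by (rule arg_cong[where f = "(^) a"]) (simp add: algebra_simps)
      moreover have "j + (m + l) = 2 * m + N + l" "j - (m + l) = N - l" "m + l - m = l"
        by (simp_all add: j)
      ultimately show "?t m (m + l) = C * (a ^ (l * (l + 3) div 2 + 2 * m * l)
        * (qbrace_fact (2 * m + N + l) / (qbrace_fact l * qbrace_fact (N - l))))"
        by (simp only: C_def) (simp add: mult_ac)
    qed simp
    also have "\<dots> = C * (a ^ (2 * N * (2 * m + N + 1)) * (qbrace_fact (2 * m + N) / qbrace_fact N))"
      by (simp only: sum_distrib_left[symmetric] sum_qbrace_fact)
    also have "\<dots> = a ^ (2 * m * (m + 1)) * a ^ (2 * N * (2 * m + N + 1))
        * (a ^ (m * (m + 3) div 2) * tuple_sum p m / qbrace_fact m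
          * (qbrace_fact (2 * m + N) / qbrace_fact N))"
      by (simp add: C_def mult_ac)
    \<comment> \<open>The exponent depends only on \<open>j = m + N\<close>, so this power leaves
      the sum over \<open>m\<close>.\<close>
    also have "a ^ (2 * m * (m + 1)) * a ^ (2 * N * (2 * m + N + 1)) = a ^ (2 * j * (j + 1))"
      unfolding power_add[symmetric]
      by (rule arg_cong[where f = "(^) a"]) (simp add: j algebra_simps)
    also have "qbrace_fact (2 * m + N) / qbrace_fact N = qbrace_fact (j + m) / qbrace_fact (j - m)"
      by (simp add: j mult_2 add_ac)
    finally show "(\<Sum>n=m..j. ?t m n) = a ^ (2 * j * (j + 1))
        * (a ^ (m * (m + 3) div 2) * tuple_sum p m / qbrace_fact m
          * (qbrace_fact (j + m) / qbrace_fact (j - m)))" .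
  qed simp
  also have "\<dots> = (a ^ (2 * j * (j + 1))) ^ Suc p"
    by (simp only: sum_distrib_left[symmetric] Suc power_Suc)
  finally show ?case .
qed


section \<open>Evaluation of series\<close>

lemma poly_R_lam_eq_0: "j < n \<Longrightarrow> poly (R n) (lam (2 * j)) = 0"
  by (auto simp: R_def poly_prod z_def)

text \<open>In the expanded product, the indices \<open>j - i\<close> and \<open>j + i + 1\<close>
  have sum \<open>2 * j + 1\<close> and difference \<open>2 * i + 1\<close>.\<close>

lemma lam_diff:
  assumes "i \<le> j"
  shows "lam (2 * j) - lam (2 * i) = - qbrace (j - i) * qbrace (j + i + 1)"
proof -
  obtain d where j: "j = i + d" using assms le_Suc_ex by blast
  have lam: "lam k = - (a ^ (k + 1)) - inverse (a ^ (k + 1))" for k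
  proof -
    have "- int k - 1 = - int (k + 1)" "int k + 1 = int (k + 1)" by simp_all
    thus ?thesis by (simp only: lam_def power_int_minus power_int_of_nat)
  qed
  define u v where "u = a ^ i" and "v = a ^ d"
  have nz: "u \<noteq> 0" "v \<noteq> 0" by (simp_all add: u_def v_def)
  have "a ^ (2 * j + 1) = u ^ 2 * v ^ 2 * a" "a ^ (2 * i + 1) = u ^ 2 * a"
    "a ^ (j - i) = v" "a ^ (j + i + 1) = u ^ 2 * v * a"
    by (simp_all add: u_def v_def j power_add power_mult power2_eq_square power_mult_distrib mult_ac)
  thus ?thesis
    unfolding lam qbrace_eq using nz
    by (simp only:) (simp add: field_simps power2_eq_square)
qed

lemma poly_R_Suc: "poly (R (Suc n)) x = poly (R n) x * (x - lam (2 * n))"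
  by (simp add: R_def z_def algebra_simps)

text \<open>The factors {j-i} and {j+i+1} with \<open>i < n\<close> together run through {j-n+1},
  ..., {j+n}.\<close>

lemma poly_R_lam:
  "n \<le> j \<Longrightarrow> poly (R n) (lam (2 * j)) = (-1) ^ n * (qbrace_fact (j + n) / qbrace_fact (j - n))"
proof (induction n)
  case (Suc n)
  have "j - n = Suc (j - Suc n)" using Suc.prems by simp
  hence f: "qbrace_fact (j - n) = qbrace_fact (j - Suc n) * qbrace (j - n)"
    by (metis qbrace_fact_Suc)
  have nz: "qbrace (j - n) \<noteq> 0" using Suc.prems by simp
  have "poly (R (Suc n)) (lam (2 * j)) = poly (R n) (lam (2 * j)) * (lam (2 * j) - lam (2 * n))"
    by (rule poly_R_Suc)
  also have "\<dots> = (-1) ^ n * (qbrace_fact (j + n) / qbrace_fact (j - n))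
      * (- qbrace (j - n) * qbrace (j + n + 1))"
    using Suc by (simp add: lam_diff)
  finally show ?case
    using nz by (simp add: f qbrace_fact_Suc)
qed (simp add: R_def)

lemma poly_R_lam_diag_nz: "poly (R j) (lam (2 * j)) \<noteq> 0"
  by (simp add: poly_R_lam)

text \<open>Up to the factor \<open>[2j + 1]\<close> this is the pairing of the series \<open>c\<close> with
  \<open>e\<^sub>2\<^sub>j\<close>; see \<open>sum_form_e_even\<close>.\<close>

definition series_eval :: "series \<Rightarrow> nat \<Rightarrow> QA" where
  "series_eval c j = (\<Sum>n\<le>j. c n * poly (R n) (lam (2 * j)))"

text \<open>The evaluations form a triangular system with nonzero diagonal. This yields the
  uniqueness of \<open>omega\<close> and identifies the coefficients of its powers.\<close>

lemma series_eval_inject: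
  assumes "\<And>j. series_eval c j = series_eval d j"
  shows "c = d"
proof
  fix n
  show "c n = d n"
  proof (induction n rule: less_induct)
    case (less n)
    have split: "series_eval f n = (\<Sum>k<n. f k * poly (R k) (lam (2 * n))) + f n * poly (R n) (lam (2 * n))" for f
      by (simp add: series_eval_def flip: lessThan_Suc_atMost)
    have "(\<Sum>k<n. c k * poly (R k) (lam (2 * n))) = (\<Sum>k<n. d k * poly (R k) (lam (2 * n)))"
      using less by simp
    thus ?case
      using assms[of n] poly_R_lam_diag_nz[of n] by (simp add: split)
  qed
qed

lemma series_eval_one: "series_eval series_one j = 1"
proof -
  have "series_eval series_one j = (\<Sum>n\<le>j. if n = 0 then 1 else 0)"
    unfolding series_eval_def by (rule sum.cong) (auto simp: series_one_def R_def)
  thus ?thesis by simp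
qed

lemma poly_R_mult_lam:
  "poly (R n) (lam (2 * j)) * poly (R m) (lam (2 * j))
     = (\<Sum>k\<le>j. coords R (R n * R m) k * poly (R k) (lam (2 * j)))"
proof -
  \<comment> \<open>\<open>M\<close> exceeds the degree, so the expansion is complete, and exceeds
    \<open>j\<close>, so the range can be cut down to \<open>k \<le> j\<close>.\<close>
  define M where "M = Suc (degree (R n * R m) + j)"
  have "R n * R m = (\<Sum>k<M. smult (coords R (R n * R m) k) (R k))"
    by (rule coords_R(2)) (simp add: M_def)
  hence "poly (R n * R m) (lam (2 * j))
      = poly (\<Sum>k<M. smult (coords R (R n * R m) k) (R k)) (lam (2 * j))"
    by (rule arg_cong)
  hence "poly (R n) (lam (2 * j)) * poly (R m) (lam (2 * j))
      = (\<Sum>k<M. coords R (R n * R m) k * poly (R k) (lam (2 * j)))"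
    by (simp only: poly_mult poly_sum poly_smult)
  also have "\<dots> = (\<Sum>k\<le>j. coords R (R n * R m) k * poly (R k) (lam (2 * j)))"
    by (rule sum.mono_neutral_right) (auto simp: M_def poly_R_lam_eq_0)
  finally show ?thesis .
qed

lemma series_eval_mult: "series_eval (series_mult c d) j = series_eval c j * series_eval d j"
proof -
  let ?C = "\<lambda>n m k. coords R (R n * R m) k"
  let ?P = "\<lambda>k. poly (R k) (lam (2 * j))"
  \<comment> \<open>The structure constants vanish for \<open>k < max n m\<close>, so the inner
    ranges can be enlarged to the fixed bound \<open>j\<close> and the sums exchanged.\<close>
  have ext: "(\<Sum>n\<le>k. \<Sum>m\<le>k. c n * d m * ?C n m k) = (\<Sum>n\<le>j. \<Sum>m\<le>j. c n * d m * ?C n m k)"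
    if "k \<le> j" for k
  proof -
    have "(\<Sum>m\<le>k. c n * d m * ?C n m k) = (\<Sum>m\<le>j. c n * d m * ?C n m k)" for n
      using that by (intro sum.mono_neutral_left) (auto simp: coords_R_mult_eq_0)
    thus ?thesis
      using that by (simp, intro sum.mono_neutral_left ballI sum.neutral) (auto simp: coords_R_mult_eq_0)
  qed
  have "series_eval (series_mult c d) j
      = (\<Sum>k\<le>j. \<Sum>n\<le>j. \<Sum>m\<le>j. c n * d m * ?C n m k * ?P k)"
    by (simp add: series_eval_def series_mult_def ext sum_distrib_right)
  also have "\<dots> = (\<Sum>n\<le>j. \<Sum>k\<le>j. \<Sum>m\<le>j. c n * d m * ?C n m k * ?P k)"
    by (rule sum.swap)
  also have "\<dots> = (\<Sum>n\<le>j. \<Sum>m\<le>j. \<Sum>k\<le>j. c n * d m * ?C n m k * ?P k)"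
    by (intro sum.cong refl sum.swap)
  also have "\<dots> = (\<Sum>n\<le>j. \<Sum>m\<le>j. c n * d m * (?P n * ?P m))"
    by (simp add: poly_R_mult_lam sum_distrib_left mult.assoc)
  also have "\<dots> = series_eval c j * series_eval d j"
    by (simp add: series_eval_def sum_product mult_ac)
  finally show ?thesis .
qed

lemma series_eval_power: "series_eval (series_power c p) j = series_eval c j ^ p"
  by (induction p) (simp_all add: series_eval_one series_eval_mult)


section \<open>The series \<open>\<omega>\<close>\<close>

text \<open>\<open>z ^ k\<close> lies in the span of the \<open>e i\<close> with
  \<open>i \<le> k\<close> of the same parity. Phrasing this through functionals avoids
  coefficients: the induction passes from \<open>L\<close> to
  \<open>\<lambda>x. L (z * x)\<close>.\<close>

lemma linear_vanish_power:
  fixes L :: "QA poly \<Rightarrow> QA"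
  assumes "\<And>x y. L (x + y) = L x + L y" "\<And>u x. L (smult u x) = u * L x"
    and "\<And>i. i \<le> k \<Longrightarrow> even (i + k) \<Longrightarrow> L (e i) = 0"
  shows "L (z ^ k) = 0"
  using assms
proof (induction k arbitrary: L)
  case 0
  thus ?case using 0(3)[of 0] by simp
next
  case (Suc k)
  have "L (z * z ^ k) = 0"
  proof (rule Suc.IH[of "\<lambda>x. L (z * x)"])
    fix i assume i: "i \<le> k" "even (i + k)"
    show "L (z * e i) = 0"
    proof (cases i)
      case 0
      thus ?thesis using Suc.prems(3)[of 1] i by simp
    next
      case (Suc l)
      have "z * e i = e (Suc i) + e l" using Suc by simp
      hence "L (z * e i) = L (e (Suc i)) + L (e l)" by (simp only: Suc.prems(1))
      also have "\<dots> = 0" using Suc.prems(3)[of "Suc i"] Suc.prems(3)[of l] i Suc by simp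
      finally show ?thesis .
    qed
  qed (simp_all add: Suc.prems(1,2) distrib_left mult_smult_right)
  thus ?case by simp
qed

text \<open>The converse inclusion of spans, by the same device applied to the recursion of
  \<open>e\<close>.\<close>

lemma linear_vanish_e:
  fixes L :: "QA poly \<Rightarrow> QA"
  assumes "\<And>x y. L (x + y) = L x + L y" "\<And>u x. L (smult u x) = u * L x"
    and "\<And>k. k \<le> i \<Longrightarrow> even (i + k) \<Longrightarrow> L (z ^ k) = 0"
  shows "L (e i) = 0"
  using assms
proof (induction i arbitrary: L rule: e.induct)
  case 1
  thus ?case using 1(3)[of 0] by simp
next
  case 2
  thus ?case using 2(3)[of 1] by simp
next
  case (3 i)
  have 1: "L (z * e (Suc i)) = 0"
  proof (rule 3(1)[of "\<lambda>x. L (z * x)"])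
    fix k assume "k \<le> Suc i" "even (Suc i + k)"
    thus "L (z * z ^ k) = 0" using 3(5)[of "Suc k"] by simp
  qed (simp_all add: 3(3,4) distrib_left mult_smult_right)
  have 2: "L (e i) = 0"
    by (rule 3(2)[OF 3(3,4)]) (auto intro: 3(5))
  have "e (Suc (Suc i)) = z * e (Suc i) + smult (-1) (e i)"
    by simp
  hence "L (e (Suc (Suc i))) = L (z * e (Suc i)) + (-1) * L (e i)"
    by (simp only: 3(3,4))
  thus ?case using 1 2 by simp
qed

lemma form_sum_smult_right:
  "form f (\<Sum>k<(m::nat). smult (c k) (g k)) = (\<Sum>k<m. c k * form f (g k))"
proof (induction m)
  case 0
  show ?case using form_smult_right[of f 0 0] by simp
qed (simp add: form_add_right form_smult_right)

text \<open>A summation range depending only on \<open>m\<close> replaces the support of the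
  pairing, which varies with \<open>x\<close>.\<close>

lemma series_form_bound:
  assumes "x = (\<Sum>k<m. smult (c k) (z ^ (2 * k)))"
  shows "series_form w x = (\<Sum>n<m. w n * form (R n) x)"
proof -
  have "form (R n) x = 0" if "m \<le> n" for n
    using that by (simp add: assms form_sum_smult_right form_R_even)
  thus ?thesis
    unfolding series_form_def using not_less
    by (intro sum.mono_neutral_left) auto
qed

lemma even_power_eq_sum:
  assumes "k < m"
  shows "z ^ (2 * k) = (\<Sum>i<m. smult (if i = k then 1 else 0) (z ^ (2 * i)))"
proof -
  have "(\<Sum>i<m. smult (if i = k then 1 else 0) (z ^ (2 * i))) = (\<Sum>i<m. if i = k then z ^ (2 * i) else 0)"
    by (rule sum.cong) auto
  thus ?thesis using assms by simp
qed

lemma even_power_in_skeinBev: "z ^ (2 * k) \<in> skeinBev"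
proof -
  have "(1::QA) = to_fract 1 / indetA ^ 0" "(0::QA) = to_fract 0 / indetA ^ 0" by simp_all
  hence "(1::QA) \<in> laurent_ring" "(0::QA) \<in> laurent_ring"
    unfolding laurent_ring_def by blast+
  thus ?thesis
    unfolding skeinBev_def using even_power_eq_sum[of k "Suc k"]
    by (intro CollectI exI[of _ "\<lambda>i. if i = k then 1 else 0"] exI[of _ "Suc k"]) auto
qed

lemma sum_form_e_even:
  assumes "j < m"
  shows "(\<Sum>n<m. w n * form (R n) (e (2 * j))) = series_eval w j * qint (2 * j + 1)"
proof -
  have "(\<Sum>n<m. w n * form (R n) (e (2 * j))) = (\<Sum>n\<le>j. w n * form (R n) (e (2 * j)))"
    using assms by (intro sum.mono_neutral_right) (auto simp: form_e poly_R_lam_eq_0)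
  also have "\<dots> = series_eval w j * qint (2 * j + 1)"
    unfolding series_eval_def sum_distrib_right by (rule sum.cong) (simp_all add: form_e)
  finally show ?thesis .
qed

lemma bracket_twist_e_even: "bracket (twist (e (2 * j))) = a ^ (2 * j * (j + 1)) * qint (2 * j + 1)"
proof -
  have "mu (2 * j) = a ^ (2 * j * (j + 1))"
    unfolding mu_def a_def power_mult[symmetric]
    by (simp, rule arg_cong[where f = "(^) indetA"]) (simp add: power2_eq_square algebra_simps)
  moreover have "form (e (2 * j)) 1 = qint (2 * j + 1)"
    using form_e_e[of "2 * j" 0] by simp
  ultimately show ?thesis
    by (simp add: bracket_def twist_e form_smult_left)
qed

text \<open>The even powers of \<open>z\<close> and the \<open>e (2 * j)\<close> have the same span,
  and on \<open>e (2 * j)\<close> the two pairings are the evaluations on the right times the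
  nonzero [2j+1].\<close>

lemma series_form_eq_twist_iff:
  "(\<forall>x\<in>skeinBev. series_form w x = bracket (twist x))
     \<longleftrightarrow> (\<forall>j. series_eval w j = a ^ (2 * j * (j + 1)))"
proof -
  \<comment> \<open>The truncated defect is linear on all polynomials and is the true defect on
    combinations of the \<open>z ^ (2 * k)\<close> with \<open>k < m\<close>.\<close>
  define L where "L m x = (\<Sum>n<m. w n * form (R n) x) - bracket (twist x)" for m x
  have add: "L m (x + y) = L m x + L m y" for m x y
    by (simp add: L_def form_add_right twist_add bracket_def form_add_left algebra_simps sum.distrib)
  have smult: "L m (smult u x) = u * L m x" for m u x
    by (simp add: L_def form_smult_right twist_smult bracket_def form_smult_left algebra_simps sum_distrib_left)
  have L_e: "L m (e (2 * j)) = (series_eval w j - a ^ (2 * j * (j + 1))) * qint (2 * j + 1)" if "j < m" for m j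
    unfolding L_def sum_form_e_even[OF that] bracket_twist_e_even by (rule left_diff_distrib[symmetric])
  have nz: "qint (2 * j + 1) \<noteq> 0" for j
    by (simp add: qint_def)
  show ?thesis
  proof (intro iffI allI ballI)
    fix j assume *: "\<forall>x\<in>skeinBev. series_form w x = bracket (twist x)"
    have "L (Suc j) (e (2 * j)) = 0"
    proof (rule linear_vanish_e[OF add smult])
      fix k assume "k \<le> 2 * j" "even (2 * j + k)"
      then obtain i where i: "k = 2 * i" "i < Suc j" by (auto elim!: evenE)
      show "L (Suc j) (z ^ k) = 0"
        using * even_power_in_skeinBev[of i] series_form_bound[OF even_power_eq_sum[OF i(2)], of w]
        unfolding L_def i(1) by simp
    qed
    thus "series_eval w j = a ^ (2 * j * (j + 1))"
      using nz L_e[of j "Suc j"] by simp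
  next
    fix x assume *: "\<forall>j. series_eval w j = a ^ (2 * j * (j + 1))" and "x \<in> skeinBev"
    then obtain c m where x: "x = (\<Sum>k<m. smult (c k) (z ^ (2 * k)))"
      unfolding skeinBev_def by blast
    have van: "L m (z ^ (2 * k)) = 0" if "k < m" for k
    proof (rule linear_vanish_power[OF add smult])
      fix i assume "i \<le> 2 * k" "even (i + 2 * k)"
      hence "i = 2 * (i div 2)" "i div 2 < m" using that by auto
      then obtain l where "i = 2 * l" "l < m" by blast
      thus "L m (e i) = 0" using * by (simp add: L_e)
    qed
    have "L m (\<Sum>k<l. smult (c k) (z ^ (2 * k))) = 0" if "l \<le> m" for l
      using that
    proof (induction l)
      case 0
      show ?case using smult[of m 0 0] by simp
    qed (simp add: add smult van)
    hence "L m x = 0" by (simp add: x)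
    thus "series_form w x = bracket (twist x)"
      by (simp add: L_def series_form_bound[OF x])
  qed
qed

text \<open>The claimed coefficient with respect to \<open>R n\<close> rather than
  \<open>R' n\<close>, hence the division by \<open>qbrace_fact n\<close>.\<close>

definition omega_coeff :: "nat \<Rightarrow> nat \<Rightarrow> QA" where
  "omega_coeff p n = (-1) ^ n * a ^ (n * (n + 3) div 2) * tuple_sum p n / qbrace_fact n"

lemma series_eval_omega_coeff: "series_eval (omega_coeff p) j = (a ^ (2 * j * (j + 1))) ^ p"
proof -
  have "series_eval (omega_coeff p) j = (\<Sum>n\<le>j. a ^ (n * (n + 3) div 2) * tuple_sum p n / qbrace_fact n
      * (qbrace_fact (j + n) / qbrace_fact (j - n)))"
    unfolding series_eval_def
  proof (rule sum.cong)
    fix n assume "n \<in> {..j}"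
    \<comment> \<open>The sign in \<open>omega_coeff\<close> cancels the one in
      \<open>poly_R_lam\<close>.\<close>
    moreover have "(-1) ^ n * (-1) ^ n = (1 :: QA)" by (simp flip: power_mult_distrib)
    ultimately show "omega_coeff p n * poly (R n) (lam (2 * j)) = a ^ (n * (n + 3) div 2) * tuple_sum p n
        / qbrace_fact n * (qbrace_fact (j + n) / qbrace_fact (j - n))"
      by (simp add: omega_coeff_def poly_R_lam)
  qed simp
  thus ?thesis by (simp only: sum_tuple_sum)
qed

lemma series_eval_omega: "series_eval omega j = a ^ (2 * j * (j + 1))"
proof -
  \<comment> \<open>The claimed formula for \<open>p = 1\<close> provides the existence that the
    definite description of \<open>omega\<close> requires.\<close>
  have *: "omega = omega_coeff 1"
    unfolding omega_def series_form_eq_twist_iff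
    by (rule the_equality) (auto intro!: series_eval_inject simp: series_eval_omega_coeff)
  show ?thesis unfolding * by (simp add: series_eval_omega_coeff)
qed

lemma series_power_omega: "series_power omega p = omega_coeff p"
  by (rule series_eval_inject)
    (simp add: series_eval_power series_eval_omega series_eval_omega_coeff)

theorem theorem4p5:
  fixes p n :: nat
  assumes "p \<ge> 1"
  shows "c' n p = (-1) ^ n * a ^ (n * (n + 3) div 2) *
    (\<Sum>k\<in>tuples p n. a ^ phi k * (qfact n / (\<Prod>i\<leftarrow>k. qfact i)))"
proof -
  have "c' n p = omega_coeff p n * qbrace_fact n"
    unfolding c'_def series_power_omega
  proof (rule the_equality)
    fix y assume "smult (omega_coeff p n) (R n) = smult y (R' n)"
    hence "smult (omega_coeff p n) (R n) = smult (y * inverse (qbrace_fact n)) (R n)"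
      by (simp add: R'_def)
    hence "smult (omega_coeff p n - y * inverse (qbrace_fact n)) (R n) = 0"
      by (simp only: smult_diff_left diff_self)
    thus "y = omega_coeff p n * qbrace_fact n"
      \<comment> \<open>Uniqueness of \<open>y\<close>: the nonzero polynomial \<open>R n\<close>
        can be cancelled.\<close>
      using R_nz[of n] by (simp add: field_simps)
  qed (simp add: R'_def mult.assoc)
  thus ?thesis by (simp add: omega_coeff_def tuple_sum_def)
qed

end
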